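(* For every constant $C\ge 1$ there is a constant $c>0$ such that the following holds. For every number of cups $n$ and every $k$ with $1\le k\le Cn$, if the emptier follows the greedy emptying strategy in the variable-processor cup game on $n$ cups (starting from all fills $0$), then no filler can achieve backlog $k$ within fewer than $c\left(k + \frac{k^3}{\log^2 (n/k+2)}\right)$ rounds.
   Context: The (standard) variable-processor cup game on $n$ cups: there are $n$ cups with real fills $x_1,\dots,x_n$, all initially $0$, and two adaptive players, a filler and an emptier. In each round the filler chooses an integer $1\le p\le n$ and reals $a_1,\dots,a_n\in[0,1]$ with $\sum_i a_i = p$, and replaces each $x_i$ by $x_i+a_i$; then the emptier chooses a set $S$ of exactly $p$ cups and replaces $x_i$ by $\max(0,x_i-1)$ for each $i\in S$. The backlog of a state is $\max_i x_i$. The greedy emptier, in each round, chooses $S$ to be $p$ cups with the largest fills (after the filler's move), ties broken arbitrarily. *)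

theory Defs
  imports Complex_Main
begin

text \<open>One round of the variable-processor cup game on cups 0..<n with the greedy emptier.
  x = fills before the round, p = number of processors, a = filler's distribution,
  x' = fills after the round. The emptier empties a set S of exactly p cups with
  the largest fills after the filler's move (ties broken arbitrarily).\<close>
definition greedy_round :: "nat \<Rightarrow> (nat \<Rightarrow> real) \<Rightarrow> nat \<Rightarrow> (nat \<Rightarrow> real) \<Rightarrow> (nat \<Rightarrow> real) \<Rightarrow> bool" where
  "greedy_round n x p a x' \<longleftrightarrow>
     1 \<le> p \<and> p \<le> n \<and>
     (\<forall>i<n. 0 \<le> a i \<and> a i \<le> 1) \<and>
     (\<Sum>i<n. a i) = real p \<and>
     (\<exists>S. S \<subseteq> {..<n} \<and> card S = p \<and>
          (\<forall>i\<in>S. \<forall>j\<in>{..<n} - S. x j + a j \<le> x i + a i) \<and>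
          (\<forall>i<n. x' i = (if i \<in> S then max 0 (x i + a i - 1) else x i + a i)))"

definition greedy_play :: "nat \<Rightarrow> (nat \<Rightarrow> nat \<Rightarrow> real) \<Rightarrow> nat \<Rightarrow> bool" where
  "greedy_play n xs t \<longleftrightarrow>
     (\<forall>i<n. xs 0 i = 0) \<and>
     (\<forall>s<t. \<exists>p a. greedy_round n (xs s) p a (xs (Suc s)))"

end

theory Submission
  imports Defs
begin

text \<open>
  For an integer level \<open>q\<close> let \<open>h(q)\<close> be the total fill above \<open>q\<close>. If \<open>\<theta>\<close> is the smallest fill
  that greedy empties in a round, then \<open>h\<close> can increase only at \<open>q = \<lfloor>\<theta>\<rfloor>\<close>, and since \<open>h\<close> is convex
  with integer slopes, the new \<open>h(q)\<close> is at most \<open>min (h(q+1) + j, h(q-1) - j)\<close>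
  for some integer \<open>j\<close>; in particular it is at most the average of its two neighbours.

  Two consequences give the bound. First, a staircase of one cup per level is a barrier: if
  \<open>h(K) \<le> J(J+1)/2\<close> at all times, then the backlog never exceeds \<open>K + J\<close>. So backlog \<open>k\<close> forces
  \<open>h(k/4)\<close> to reach order \<open>k\<^sup>2\<close>, whereas \<open>h(0)\<close> is at most of order \<open>nk\<close>. Second, replacing a value
  by the average of its neighbours decreases the Dirichlet energy by the square of the change, so
  by Cauchy-Schwarz it takes order \<open>w\<^sup>3\<close> rounds to carry a constant fraction of the maximum of \<open>h\<close>
  across a block of \<open>w\<close> levels (this is the argument for the maximum overhang problem). Cutting
  \<open>{0..k/4}\<close> into about \<open>ln (n/k + 2)\<close> blocks, a typical block loses only a constant factor, and each
  round is charged to a single block.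
\<close>

section \<open>Greedy rounds as local relaxations of the excess profile\<close>

text \<open>\<open>j\<close> stands for the slope of the profile at \<open>q\<close>. Keeping it a
  natural number is stronger than the averaging inequality, and the staircase argument needs that
  integrality.\<close>

definition relax_step :: "(nat \<Rightarrow> real) \<Rightarrow> (nat \<Rightarrow> real) \<Rightarrow> nat \<Rightarrow> bool" where
  "relax_step g g' q \<longleftrightarrow> (\<forall>r. r \<noteq> q \<longrightarrow> g' r \<le> g r) \<and>
     (q > 0 \<longrightarrow> (\<exists>j::nat. g' q \<le> g (Suc q) + real j \<and> g' q + real j \<le> g (q - 1)))"

lemma relax_step_le: "relax_step g g' q \<Longrightarrow> r \<noteq> q \<Longrightarrow> g' r \<le> g r"
  by (simp add: relax_step_def)

lemma relax_step_average:
  assumes "relax_step g g' q" "q > 0"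
  shows "g' q \<le> (g (q - 1) + g (Suc q)) / 2"
  using assms unfolding relax_step_def by force

definition excess :: "nat \<Rightarrow> (nat \<Rightarrow> real) \<Rightarrow> nat \<Rightarrow> real" where
  "excess n x q = (\<Sum>i<n. max 0 (x i - real q))"

lemma excess_antimono: "q \<le> r \<Longrightarrow> excess n x r \<le> excess n x q"
  unfolding excess_def by (intro sum_mono) auto

text \<open>Take for \<open>j\<close> the number of cups above \<open>q\<close>: raising the level
  by one costs each of them at most 1, lowering it gains each of them exactly 1.\<close>

lemma excess_slope:
  fixes x :: "nat \<Rightarrow> real"
  shows "\<exists>j::nat. excess n x q \<le> excess n x (Suc q) + real j \<and>
    (q > 0 \<longrightarrow> excess n x q + real j \<le> excess n x (q - 1))"
proof -
  define j where "j = card {i\<in>{..<n}. x i > real q}"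
  have j: "real j = (\<Sum>i<n. if x i > real q then 1 else 0)"
    unfolding j_def by (simp add: sum.If_cases Int_def)
  have "excess n x q \<le> excess n x (Suc q) + real j"
    unfolding excess_def j sum.distrib[symmetric] by (intro sum_mono) auto
  moreover have "excess n x q + real j \<le> excess n x (q - 1)" if "q > 0"
    unfolding excess_def j sum.distrib[symmetric] using that
    by (intro sum_mono) (auto simp: of_nat_diff)
  ultimately show ?thesis by blast
qed

text \<open>Let \<open>\<theta>\<close> be the smallest fill emptied. At levels
  \<open>r \<ge> \<theta>\<close>, unemptied cups contribute nothing and emptied ones have no net
  gain. At levels \<open>r \<le> \<theta> - 1\<close>, each emptied cup loses a full unit of excess,
  which pays for the \<open>p\<close> units poured.\<close>

lemma greedy_round_relax_step:
  assumes "greedy_round n x p a x'"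
  shows "\<exists>q. relax_step (excess n x) (excess n x') q"
proof -
  from assms obtain S where p: "1 \<le> p" and a: "\<forall>i<n. 0 \<le> a i \<and> a i \<le> 1" "(\<Sum>i<n. a i) = real p"
    and S: "S \<subseteq> {..<n}" "card S = p" "\<forall>i\<in>S. \<forall>j\<in>{..<n} - S. x j + a j \<le> x i + a i"
    and x': "\<forall>i<n. x' i = (if i \<in> S then max 0 (x i + a i - 1) else x i + a i)"
    unfolding greedy_round_def by blast
  have fin: "finite S"
    using S(1) by (rule finite_subset) simp
  have ne: "S \<noteq> {}"
    using S(2) p by auto
  define \<theta> where "\<theta> = Min ((\<lambda>i. x i + a i) ` S)"
  have \<theta>_in: "\<theta> \<le> x i + a i" if "i \<in> S" for i
    unfolding \<theta>_def using that fin by (intro Min_le) auto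
  have \<theta>_out: "x i + a i \<le> \<theta>" if "i < n" "i \<notin> S" for i
    unfolding \<theta>_def using S(3) that fin ne by (subst Min_ge_iff) auto
  have above: "excess n x' r \<le> excess n x r" if "\<theta> \<le> real r" for r
    unfolding excess_def
  proof (rule sum_mono)
    fix i assume "i \<in> {..<n}"
    then have i: "i < n" by simp
    show "max 0 (x' i - real r) \<le> max 0 (x i - real r)"
      using x' a(1) \<theta>_out[OF i] that i by (cases "i \<in> S") (auto simp: max_def)
  qed
  have below: "excess n x' r \<le> excess n x r" if "real r \<le> \<theta> - 1" for r
  proof -
    have "real p = (\<Sum>i<n. if i \<in> S then 1 else 0)"
      using S by (simp add: sum.If_cases Int_absorb1)
    moreover have "(\<Sum>i<n. max 0 (x' i - real r) + (if i \<in> S then 1 else 0))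
        \<le> (\<Sum>i<n. max 0 (x i - real r) + a i)"
    proof (rule sum_mono)
      fix i assume "i \<in> {..<n}"
      then have i: "i < n" by simp
      show "max 0 (x' i - real r) + (if i \<in> S then 1 else 0) \<le> max 0 (x i - real r) + a i"
        using x' a(1) \<theta>_in[of i] that i by (cases "i \<in> S") (auto simp: max_def)
    qed
    ultimately show ?thesis
      unfolding excess_def using a(2) by (simp add: sum.distrib)
  qed
  \<comment> \<open>\<open>above\<close> and \<open>below\<close> miss only an integer strictly
    between \<open>\<theta> - 1\<close> and \<open>\<theta>\<close>, which is \<open>q\<close>. If
    \<open>\<theta>\<close> is negative, \<open>above\<close> covers every level.\<close>
  define q where "q = nat \<lfloor>\<theta>\<rfloor>"
  have "excess n x' r \<le> excess n x r" if "r \<noteq> q" for r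
  proof (cases "\<theta> \<le> real r")
    case False
    then have "real_of_int (int r + 1) \<le> \<theta>"
      using that unfolding q_def le_floor_iff[symmetric] by linarith
    then show ?thesis by (intro below) simp
  qed (rule above)
  moreover have "\<exists>j::nat. excess n x' q \<le> excess n x (Suc q) + real j \<and>
      excess n x' q + real j \<le> excess n x (q - 1)" if "q > 0"
  proof -
    have q: "real q \<le> \<theta>" "\<theta> \<le> real (Suc q)"
      using that unfolding q_def by linarith+
    \<comment> \<open>The slope comes from the new fills; both neighbours are then replaced by their
      old values, which are at least as large.\<close>
    obtain j :: nat where "excess n x' q \<le> excess n x' (Suc q) + real j"
        "excess n x' q + real j \<le> excess n x' (q - 1)"
      using excess_slope[of n x' q] \<open>q > 0\<close> by (elim exE conjE) (rule that, auto)
    moreover have "excess n x' (Suc q) \<le> excess n x (Suc q)"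
      using q by (intro above)
    moreover have "excess n x' (q - 1) \<le> excess n x (q - 1)"
      using q \<open>q > 0\<close> by (intro below) (simp add: of_nat_diff)
    ultimately show ?thesis
      by (intro exI[of _ j]) linarith
  qed
  ultimately show ?thesis
    unfolding relax_step_def by blast
qed

section \<open>The staircase barrier\<close>

text \<open>From level \<open>K\<close> up, \<open>F\<close> is the excess of cups with fills
  \<open>K + 1, ..., K + J\<close>, and \<open>g s \<le> F\<close> there is invariant. For
  \<open>q \<le> K + J\<close> the slopes of \<open>F\<close> on the two sides of \<open>q\<close>
  are the consecutive integers \<open>d q\<close> and \<open>d q + 1\<close>, so for every integer
  \<open>j\<close> one of the two inequalities of \<open>relax_step\<close> suffices. Averaging
  alone would overshoot \<open>F q\<close> by 1/2.\<close>

lemma staircase_barrier: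
  fixes g :: "nat \<Rightarrow> nat \<Rightarrow> real"
  assumes step: "\<And>s. s < t \<Longrightarrow> relax_step (g s) (g (Suc s)) (act s)"
    and init: "\<And>q. g 0 q = 0"
    and bound: "\<And>s. s \<le> t \<Longrightarrow> g s K \<le> real J * (real J + 1) / 2"
  shows "g t (K + J) \<le> 0"
proof -
  \<comment> \<open>Truncated subtraction makes \<open>F\<close> vanish from \<open>K + J\<close>
    on, so the induction can run over all \<open>q \<ge> K\<close>.\<close>
  define d where "d q = real (K + J - q)" for q
  define F where "F q = d q * (d q + 1) / 2" for q
  have "g s q \<le> F q" if "s \<le> t" "K \<le> q" for s q
    using that
  proof (induction s arbitrary: q)
    case 0
    then show ?case by (simp add: init F_def d_def)
  next
    case (Suc s)
    have step_s: "relax_step (g s) (g (Suc s)) (act s)"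
      using step Suc.prems by simp
    consider "q = K" | "q \<noteq> act s" | "q > K" "q = act s"
      using Suc.prems by linarith
    then show ?case
    proof cases
      case 1
      then show ?thesis using bound[of "Suc s"] Suc.prems by (simp add: F_def d_def)
    next
      case 2
      then show ?thesis
        using relax_step_le[OF step_s] Suc.IH[of q] Suc.prems by fastforce
    next
      case 3
      then obtain j :: nat where j: "g (Suc s) q \<le> g s (Suc q) + real j"
          "g (Suc s) q + real j \<le> g s (q - 1)"
        using step_s unfolding relax_step_def by auto
      have IH: "g s (Suc q) \<le> F (Suc q)" "g s (q - 1) \<le> F (q - 1)"
        using Suc.IH Suc.prems 3 by auto
      show ?thesis
      proof (cases "j \<le> K + J - q")
        case True
        have "F (Suc q) + d q = F q"
        proof (cases "q < K + J")
          case True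
          then have "d q = d (Suc q) + 1" unfolding d_def by (simp add: of_nat_diff)
          then show ?thesis unfolding F_def by (simp add: field_simps)
        qed (simp add: F_def d_def)
        moreover have "real j \<le> d q" using True by (simp add: d_def)
        ultimately show ?thesis using j(1) IH(1) by linarith
      next
        case False
        have "F (q - 1) \<le> F q + d q + 1"
        proof (cases "q \<le> K + J")
          case True
          then have "d (q - 1) = d q + 1" using 3 unfolding d_def by (simp add: of_nat_diff)
          then show ?thesis unfolding F_def by (simp add: field_simps)
        next
          case False
          then show ?thesis unfolding F_def d_def by simp
        qed
        moreover have "d q + 1 \<le> real j" using False by (simp add: d_def)
        ultimately show ?thesis using j(2) IH(2) by linarith
      qed
    qed
  qed
  from this[of t "K + J"] show ?thesis by (simp add: F_def d_def)
qed

section \<open>Energy estimate for one block\<close>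

text \<open>Dirichlet energy plus a linear term. The linear term builds the Cauchy-Schwarz step into
  the potential: one relaxation raises it by a bounded amount, however far the value moves.\<close>

definition potential :: "real \<Rightarrow> nat \<Rightarrow> (nat \<Rightarrow> real) \<Rightarrow> real" where
  "potential \<mu> w H = (\<Sum>i<w. 2 * \<mu> * H (Suc i) + (H (Suc i) - H i)\<^sup>2)"

text \<open>The free boundary condition at \<open>w\<close> makes the blocks independent of what happens above them.\<close>

definition relaxed_value :: "nat \<Rightarrow> (nat \<Rightarrow> real) \<Rightarrow> nat \<Rightarrow> real" where
  "relaxed_value w H q = (if q < w then (H (q - 1) + H (Suc q)) / 2 else H (q - 1))"

text \<open>Only the edges at \<open>q\<close> change. A shift by \<open>D\<close> adds
  \<open>2 * \<mu> * D\<close> to the linear term and removes \<open>2 * D\<^sup>2\<close> (inside)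
  or \<open>D\<^sup>2\<close> (at the free end) from the energy; complete the square.\<close>

lemma potential_relaxed_le:
  assumes "0 < q" "q \<le> w"
  shows "potential \<mu> w (H(q := relaxed_value w H q)) \<le> potential \<mu> w H + \<mu>\<^sup>2"
proof -
  obtain p where p: "q = Suc p" using assms gr0_conv_Suc by auto
  define H' where "H' = H(q := relaxed_value w H q)"
  define f where "f H i = 2 * \<mu> * H (Suc i) + (H (Suc i) - H i)\<^sup>2" for H :: "nat \<Rightarrow> real" and i
  have "potential \<mu> w H' - potential \<mu> w H = (\<Sum>i<w. f H' i - f H i)"
    unfolding potential_def f_def by (simp add: sum_subtractf)
  also have "\<dots> = (\<Sum>i\<in>{p, Suc p} \<inter> {..<w}. f H' i - f H i)"
    by (rule sum.mono_neutral_right) (auto simp: f_def H'_def p)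
  also have "\<dots> \<le> \<mu>\<^sup>2"
  proof (cases "q < w")
    case True
    define D where "D = (H p + H (Suc q)) / 2 - H q"
    have "{p, Suc p} \<inter> {..<w} = {p, Suc p}" using True p by auto
    then have "(\<Sum>i\<in>{p, Suc p} \<inter> {..<w}. f H' i - f H i) = 2 * \<mu> * D - 2 * D\<^sup>2"
      using True unfolding f_def H'_def p relaxed_value_def D_def
      by (simp add: field_simps power2_eq_square)
    also have "\<dots> \<le> \<mu>\<^sup>2"
      using zero_le_power2[of "\<mu> - D"] zero_le_power2[of D] unfolding power2_diff by linarith
    finally show ?thesis .
  next
    case False
    define D where "D = H p - H q"
    have "{p, Suc p} \<inter> {..<w} = {p}" using False assms p by auto
    then have "(\<Sum>i\<in>{p, Suc p} \<inter> {..<w}. f H' i - f H i) = 2 * \<mu> * D - D\<^sup>2"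
      using False unfolding f_def H'_def p relaxed_value_def D_def
      by (simp add: field_simps power2_eq_square)
    also have "\<dots> \<le> \<mu>\<^sup>2"
      using zero_le_power2[of "\<mu> - D"] unfolding power2_diff by linarith
    finally show ?thesis .
  qed
  finally show ?thesis unfolding H'_def by simp
qed

text \<open>The samples of the unit ramp sum to at most \<open>l\<close>. Its drops lie between 0
  and \<open>1 / l\<close> and sum to at most 1, so their squares sum to at most
  \<open>1 / l\<close>.\<close>

lemma potential_ramp_le:
  assumes "G > 0" "l > 0" "\<mu> \<ge> 0"
  shows "potential \<mu> w (\<lambda>q. G * max 0 (1 - real q / l)) \<le> 2 * \<mu> * G * l + G\<^sup>2 / l"
proof -
  define r where "r q = max 0 (1 - real q / l)" for q
  \<comment> \<open>\<open>\<psi>\<close> falls by a full unit at each positive sample of the ramp,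
    so the area bound telescopes.\<close>
  define \<psi> where "\<psi> q = max 0 (l - real q)" for q
  have area: "(\<Sum>i<w. r (Suc i)) \<le> l"
  proof -
    have "(\<Sum>i<w. r (Suc i)) \<le> (\<Sum>i<w. \<psi> i - \<psi> (Suc i))"
    proof (rule sum_mono)
      fix i
      show "r (Suc i) \<le> \<psi> i - \<psi> (Suc i)"
      proof (cases "real (Suc i) < l")
        case True
        then have "\<psi> i - \<psi> (Suc i) = 1" by (simp add: \<psi>_def)
        moreover have "r (Suc i) \<le> 1" using assms(2) by (simp add: r_def)
        ultimately show ?thesis by simp
      next
        case False
        then have "r (Suc i) = 0" using assms(2) by (simp add: r_def field_simps)
        then show ?thesis by (simp add: \<psi>_def)
      qed
    qed
    also have "\<dots> = \<psi> 0 - \<psi> w"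
      by (rule sum_lessThan_telescope')
    also have "\<dots> \<le> l" using assms(2) by (simp add: \<psi>_def)
    finally show ?thesis .
  qed
  have energy: "(\<Sum>i<w. (r (Suc i) - r i)\<^sup>2) \<le> 1 / l"
  proof -
    have "(\<Sum>i<w. (r (Suc i) - r i)\<^sup>2) \<le> (\<Sum>i<w. (1 / l) * (r i - r (Suc i)))"
    proof (rule sum_mono)
      fix i
      have s: "real (Suc i) / l = real i / l + 1 / l" "1 / l > 0"
        using assms(2) by (simp_all add: add_divide_distrib)
      have "0 \<le> r i - r (Suc i)" "r i - r (Suc i) \<le> 1 / l"
        unfolding r_def max_def using s by (simp_all only: split: if_split) linarith+
      then have "(r i - r (Suc i)) * (r i - r (Suc i)) \<le> (1 / l) * (r i - r (Suc i))"
        by (rule mult_right_mono[rotated])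
      then show "(r (Suc i) - r i)\<^sup>2 \<le> (1 / l) * (r i - r (Suc i))"
        by (simp add: power2_eq_square algebra_simps)
    qed
    also have "\<dots> = (1 / l) * (r 0 - r w)"
      by (simp only: sum_distrib_left[symmetric] sum_lessThan_telescope'[of r])
    also have "\<dots> \<le> (1 / l) * 1"
      using assms(2) by (intro mult_left_mono) (auto simp: r_def)
    finally show ?thesis by simp
  qed
  have "potential \<mu> w (\<lambda>q. G * r q)
      = 2 * \<mu> * G * (\<Sum>i<w. r (Suc i)) + G\<^sup>2 * (\<Sum>i<w. (r (Suc i) - r i)\<^sup>2)"
    unfolding potential_def sum.distrib sum_distrib_left
    by (simp add: mult.assoc power_mult_distrib[symmetric] right_diff_distrib)
  also have "\<dots> \<le> 2 * \<mu> * G * l + G\<^sup>2 * (1 / l)"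
    using area energy assms by (intro add_mono mult_left_mono) auto
  finally show ?thesis by (simp add: r_def)
qed

text \<open>A majorant \<open>H\<close> of \<open>g\<close> on the block, pinned to \<open>G\<close>
  at its lower end, starts as a ramp and is relaxed at each round acting in the block, which adds at
  most \<open>\<mu>\<^sup>2\<close> to its potential. Once level \<open>b + w\<close> reaches
  \<open>B\<close>, monotonicity forces \<open>H \<ge> B\<close> on the whole block, hence a large
  potential; the difference counts rounds.\<close>

lemma block_crossing_time:
  fixes g :: "nat \<Rightarrow> nat \<Rightarrow> real"
  assumes step: "\<And>s. s < t \<Longrightarrow> relax_step (g s) (g (Suc s)) (act s)"
    and init: "\<And>q. g 0 q = 0"
    and anti: "\<And>s q r. q \<le> r \<Longrightarrow> g s r \<le> g s q"
    and bound: "\<And>s. s \<le> t \<Longrightarrow> g s b \<le> G"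
    and u: "u \<le> t" "g u (b + w) \<ge> B" and B: "B > 0" and w: "w > 0"
  shows "real (card {s\<in>{..<t}. act s \<in> {b<..b + w}}) \<ge> (B / G) ^ 3 * real w ^ 3 / 8"
proof -
  have "B \<le> G" using u anti[of b "b + w" u] bound[OF u(1)] by simp
  then have G: "G > 0" using B by simp
  define \<delta> where "\<delta> = B / G"
  define W where "W = \<delta> * real w"
  have W: "W > 0" using B G w by (simp add: \<delta>_def W_def)
  text \<open>The weight that optimises the final estimate.\<close>
  define \<mu> where "\<mu> = 4 * G / W\<^sup>2"
  \<comment> \<open>Since \<open>g 0\<close> vanishes, any nonnegative profile with value
    \<open>G\<close> at 0 majorises it. Length \<open>W / 2\<close> keeps the linear part of the
    initial potential within half of the final lower bound.\<close>
  define H0 where "H0 q = G * max 0 (1 - real q / (W / 2))" for q :: nat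
  define N where "N u = card {s\<in>{..<u}. act s \<in> {b<..b + w}}" for u
  have N_Suc: "N (Suc s) = (if act s \<in> {b<..b + w} then Suc (N s) else N s)" for s
  proof -
    have "{r\<in>{..<Suc s}. act r \<in> {b<..b + w}} =
        (if act s \<in> {b<..b + w} then insert s {r\<in>{..<s}. act r \<in> {b<..b + w}}
         else {r\<in>{..<s}. act r \<in> {b<..b + w}})"
      by (auto simp: less_Suc_eq)
    then show ?thesis by (simp add: N_def)
  qed
  have "\<exists>H. H 0 = G \<and> (\<forall>q\<le>w. g s (b + q) \<le> H q) \<and>
      potential \<mu> w H \<le> potential \<mu> w H0 + \<mu>\<^sup>2 * real (N s)" if "s \<le> t" for s
    using that
  proof (induction s)
    case 0
    show ?case
      by (rule exI[of _ H0]) (use G in \<open>auto simp: H0_def init\<close>)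
  next
    case (Suc s)
    then obtain H where H: "H 0 = G" "\<And>q. q \<le> w \<Longrightarrow> g s (b + q) \<le> H q"
      "potential \<mu> w H \<le> potential \<mu> w H0 + \<mu>\<^sup>2 * real (N s)"
      by auto
    have step_s: "relax_step (g s) (g (Suc s)) (act s)"
      using step Suc.prems by simp
    have other: "g (Suc s) (b + q) \<le> H q" if "q \<le> w" "b + q \<noteq> act s" for q
      using relax_step_le[OF step_s that(2)] H(2)[OF that(1)] by simp
    show ?case
    proof (cases "act s \<in> {b<..b + w}")
      case False
      \<comment> \<open>Among the levels of the block, such a round can raise only \<open>b\<close>
        itself, where \<open>bound\<close> applies.\<close>
      have "g (Suc s) (b + q) \<le> H q" if "q \<le> w" for q
      proof (cases "q = 0")
        case True
        then show ?thesis using bound[OF Suc.prems] H(1) by simp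
      next
        case nz: False
        then have "b + q \<noteq> act s" using False that by auto
        then show ?thesis using other that by blast
      qed
      then show ?thesis using H False by (auto simp: N_Suc intro!: exI[of _ H])
    next
      case True
      then obtain q where q: "act s = b + q" "0 < q" "q \<le> w"
        by (metis add.commute greaterThanAtMost_iff le_add_diff_inverse2 less_imp_le_nat
            nat_add_left_cancel_le zero_less_diff)
      define H' where "H' = H(q := relaxed_value w H q)"
      have avg: "g (Suc s) (b + q) \<le> (g s (b + (q - 1)) + g s (b + Suc q)) / 2"
        using relax_step_average[OF step_s] q by simp
      have prev: "g s (b + (q - 1)) \<le> H (q - 1)"
        using H(2)[of "q - 1"] q by simp
      have "g (Suc s) (b + q) \<le> relaxed_value w H q"
      proof (cases "q < w")
        case True
        then show ?thesis
          using avg prev H(2)[of "Suc q"] by (simp add: relaxed_value_def)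
      next
        \<comment> \<open>At the top, monotonicity bounds the value at \<open>b + w + 1\<close> by
          that at \<open>b + w - 1\<close>, so the average is at most the lower neighbour.\<close>
        case False
        then show ?thesis
          using avg prev anti[of "b + (q - 1)" "b + Suc q" s] unfolding relaxed_value_def
          by (simp add: le_SucI)
      qed
      then have "\<forall>r\<le>w. g (Suc s) (b + r) \<le> H' r"
        using other q by (simp add: H'_def)
      moreover have "potential \<mu> w H' \<le> potential \<mu> w H0 + \<mu>\<^sup>2 * real (N (Suc s))"
        using potential_relaxed_le[OF q(2,3), of \<mu> H] H(3) True
        by (simp add: H'_def N_Suc algebra_simps)
      moreover have "H' 0 = G" using q H(1) by (simp add: H'_def)
      ultimately show ?thesis by blast
    qed
  qed
  from this[OF u(1)] obtain H where H: "\<And>q. q \<le> w \<Longrightarrow> g u (b + q) \<le> H q"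
    "potential \<mu> w H \<le> potential \<mu> w H0 + \<mu>\<^sup>2 * real (N u)"
    by auto
  have \<mu>: "\<mu> > 0" using G W by (simp add: \<mu>_def)
  have "2 * \<mu> * (W * G) = (\<Sum>i<w. 2 * \<mu> * B)"
    using G by (simp add: W_def \<delta>_def)
  also have "\<dots> \<le> potential \<mu> w H"
    unfolding potential_def
  proof (rule sum_mono)
    fix i assume "i \<in> {..<w}"
    then have "B \<le> H (Suc i)"
      using H(1)[of "Suc i"] u(2) anti[of "b + Suc i" "b + w" u] by simp
    then show "2 * \<mu> * B \<le> 2 * \<mu> * H (Suc i) + (H (Suc i) - H i)\<^sup>2"
      using \<mu> by (intro add_increasing2) auto
  qed
  also have "\<dots> \<le> 2 * \<mu> * G * (W / 2) + G\<^sup>2 / (W / 2) + \<mu>\<^sup>2 * real (N u)"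
    using H(2) potential_ramp_le[of G "W / 2" \<mu> w] G W \<mu> unfolding H0_def by simp
  finally have "\<mu> * (W * G) - 2 * G\<^sup>2 / W \<le> \<mu>\<^sup>2 * real (N u)"
    by (simp add: algebra_simps)
  moreover have "\<mu> * (W * G) - 2 * G\<^sup>2 / W = \<mu>\<^sup>2 * (W ^ 3 / 8)"
    using W G unfolding \<mu>_def by (simp add: field_simps power2_eq_square power3_eq_cube)
  ultimately have "W ^ 3 / 8 \<le> real (N u)"
    using \<mu> by simp
  also have "\<dots> \<le> real (N t)"
    unfolding N_def of_nat_le_iff using u(1) by (intro card_mono) auto
  finally show ?thesis unfolding N_def W_def \<delta>_def power_mult_distrib .
qed

section \<open>Combining the blocks\<close>

text \<open>The logarithms \<open>x i\<close> of the ratios average at least -1. Bound the convex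
  function \<open>exp (3 * x)\<close> below by its tangent at -1 and sum.\<close>

lemma sum_cubed_ratios_ge:
  fixes G :: "nat \<Rightarrow> real"
  assumes pos: "\<And>i. i \<le> M \<Longrightarrow> G i > 0" and le: "G 0 \<le> exp \<Lambda> * G M" and "\<Lambda> \<le> real M"
  shows "(\<Sum>i<M. (G (Suc i) / G i) ^ 3) \<ge> exp (- 3) * real M"
proof -
  define x where "x i = ln (G (Suc i)) - ln (G i)" for i
  have "ln (G 0) \<le> ln (exp \<Lambda> * G M)"
    using le pos[of 0] by (intro ln_mono) auto
  then have tele: "(\<Sum>i<M. x i) \<ge> - \<Lambda>"
    using pos[of M] unfolding x_def
    by (simp add: ln_mult sum_lessThan_telescope[of "\<lambda>i. ln (G i)"])
  have "exp (- 3) * real M \<le> exp (- 3) * (4 * real M + 3 * (\<Sum>i<M. x i))"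
    using tele assms(3) by (intro mult_left_mono) auto
  also have "\<dots> = (\<Sum>i<M. exp (- 3) * (1 + (3 * x i + 3)))"
    unfolding sum_distrib_left[symmetric] sum.distrib by simp
  also have "\<dots> \<le> (\<Sum>i<M. (G (Suc i) / G i) ^ 3)"
  proof (rule sum_mono)
    fix i assume "i \<in> {..<M}"
    then have G: "G i > 0" "G (Suc i) > 0" using pos by auto
    have "exp (- 3) * (1 + (3 * x i + 3)) \<le> exp (- 3) * exp (3 * x i + 3)"
      by (intro mult_left_mono exp_ge_add_one_self) auto
    also have "\<dots> = exp (x i) ^ 3"
      by (simp add: exp_add[symmetric] exp_of_nat_mult[symmetric])
    also have "exp (x i) = G (Suc i) / G i"
      using G by (simp add: x_def exp_diff)
    finally show "exp (- 3) * (1 + (3 * x i + 3)) \<le> (G (Suc i) / G i) ^ 3" .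
  qed
  finally show ?thesis .
qed

text \<open>Apply \<open>block_crossing_time\<close> to \<open>M\<close> consecutive blocks of width
  \<open>w\<close> and add up the rounds charged to them.\<close>

lemma crossing_time:
  fixes g :: "nat \<Rightarrow> nat \<Rightarrow> real"
  assumes step: "\<And>s. s < t \<Longrightarrow> relax_step (g s) (g (Suc s)) (act s)"
    and init: "\<And>q. g 0 q = 0"
    and anti: "\<And>s q r. q \<le> r \<Longrightarrow> g s r \<le> g s q"
    and bound: "\<And>s. s \<le> t \<Longrightarrow> g s 0 \<le> exp \<Lambda> * B"
    and u: "u \<le> t" "g u (M * w) \<ge> B" and B: "B > 0" and w: "w > 0" and M: "\<Lambda> \<le> real M"
  shows "real t \<ge> exp (- 3) * real M * real w ^ 3 / 8"
proof -
  \<comment> \<open>A maximum over time serves both as the bound at the bottom of one block and as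
    the value attained at the top of the block below.\<close>
  define G where "G i = Max ((\<lambda>s. g s (i * w)) ` {..t})" for i
  have G_ge: "g s (i * w) \<le> G i" if "s \<le> t" for s i
    unfolding G_def using that by (intro Max_ge) auto
  have G_ex: "\<exists>s\<le>t. G i = g s (i * w)" for i
  proof -
    have "G i \<in> (\<lambda>s. g s (i * w)) ` {..t}"
      unfolding G_def by (rule Max_in) auto
    then show ?thesis by auto
  qed
  have GB: "B \<le> G i" if "i \<le> M" for i
  proof -
    have "B \<le> g u (i * w)" using u(2) anti[of "i * w" "M * w" u] that by simp
    then show ?thesis using G_ge[OF u(1), of i] by simp
  qed
  have pos: "G i > 0" if "i \<le> M" for i using GB[OF that] B by simp
  \<comment> \<open>Half-open blocks are disjoint, so each round is charged at most once.\<close>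
  define A where "A i = {s\<in>{..<t}. act s \<in> {i * w<..i * w + w}}" for i
  have block: "(G (Suc i) / G i) ^ 3 * (real w ^ 3 / 8) \<le> real (card (A i))" if i: "i < M" for i
  proof -
    obtain s where s: "s \<le> t" "G (Suc i) = g s (Suc i * w)" using G_ex by blast
    show ?thesis
      using block_crossing_time[of t g act "i * w" "G i" s "G (Suc i)" w] step init anti G_ge s w
        pos[of "Suc i"] i
      by (simp add: A_def add.commute)
  qed
  have "G 0 \<le> exp \<Lambda> * B"
    using G_ex[of 0] bound by auto
  also have "\<dots> \<le> exp \<Lambda> * G M" using GB[of M] by simp
  finally have "exp (- 3) * real M * (real w ^ 3 / 8)
      \<le> (\<Sum>i<M. (G (Suc i) / G i) ^ 3) * (real w ^ 3 / 8)"
    using sum_cubed_ratios_ge[of M G \<Lambda>] pos M by (intro mult_right_mono) auto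
  also have "\<dots> \<le> (\<Sum>i<M. real (card (A i)))"
    unfolding sum_distrib_right using block by (intro sum_mono) auto
  also have "\<dots> = real (card (\<Union>i<M. A i))"
  proof -
    have "A i \<inter> A j = {}" if "i < j" for i j
    proof -
      have "i * w + w \<le> j * w"
        using mult_le_mono1[of "Suc i" j w] that by simp
      then show ?thesis unfolding A_def by auto
    qed
    then have "A i \<inter> A j = {}" if "i \<noteq> j" for i j
      using that by (metis inf_commute linorder_neqE_nat)
    then have "card (\<Union>i<M. A i) = (\<Sum>i<M. card (A i))"
      by (intro card_UN_disjoint) (auto simp: A_def)
    then show ?thesis by simp
  qed
  also have "\<dots> \<le> real (card {..<t})"
    unfolding of_nat_le_iff by (intro card_mono) (auto simp: A_def)
  finally show ?thesis by simp
qed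

section \<open>Bounds on fills and choice of parameters\<close>

lemma greedy_round_increase_le:
  assumes "greedy_round n x p a x'" "i < n" "x i \<le> b" "0 \<le> b"
  shows "x' i \<le> b + 1"
proof -
  have "0 \<le> a i" "a i \<le> 1" and "x' i = max 0 (x i + a i - 1) \<or> x' i = x i + a i"
    using assms(1,2) unfolding greedy_round_def by (blast, blast, metis)
  then show ?thesis using assms(3,4) by auto
qed

lemma greedy_play_fill_le:
  assumes "greedy_play n xs t" "s \<le> t" "i < n"
  shows "xs s i \<le> real s"
  using assms(2)
proof (induction s)
  case 0
  then show ?case using assms unfolding greedy_play_def by simp
next
  case (Suc s)
  then obtain p a where "greedy_round n (xs s) p a (xs (Suc s))"
    using assms(1) unfolding greedy_play_def by (meson Suc_le_lessD)
  from greedy_round_increase_le[OF this assms(3), of "real s"] Suc show ?case by simp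
qed

lemma ln_add_two_ge:
  fixes z :: real
  assumes "z \<ge> 0"
  shows "ln (z + 2) \<ge> 1 / 2"
proof -
  have "ln 2 \<le> ln (z + 2)" using assms by simp
  moreover have "- ln 2 \<le> - (1 / 2 :: real)"
    using ln_le_minus_one[of "1 / 2 :: real"] by (simp add: ln_div)
  ultimately show ?thesis by linarith
qed

text \<open>The barrier with \<open>J = K\<close> forces the excess at level \<open>K\<close> up to
  order \<open>k\<^sup>2\<close>, while at level 0 it stays within a factor
  \<open>exp (9 * L)\<close> of that. With about \<open>9 * L\<close> blocks of width
  \<open>w\<close>, the cost \<open>M * w ^ 3\<close> has order
  \<open>k ^ 3 / L\<^sup>2\<close>.\<close>

lemma greedy_backlog_cubic_time:
  assumes play: "greedy_play n xs t" and i: "i < n" "xs t i \<ge> k"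
    and first: "\<And>s j. s < t \<Longrightarrow> j < n \<Longrightarrow> xs s j < k" and k: "k \<ge> 8"
  defines "L \<equiv> ln (real n / k + 2)"
  assumes large: "k \<ge> 88 * L"
  shows "real t \<ge> k ^ 3 / L\<^sup>2 / 2 ^ 27"
proof -
  have t0: "t > 0"
    using play i k unfolding greedy_play_def by (cases t) auto
  have rounds: "\<exists>p a. greedy_round n (xs s) p a (xs (Suc s))" if "s < t" for s
    using play that unfolding greedy_play_def by blast
  define g where "g s = excess n (xs s)" for s
  have "\<forall>s. \<exists>q. s < t \<longrightarrow> relax_step (g s) (g (Suc s)) q"
    using rounds greedy_round_relax_step unfolding g_def by blast
  then obtain act where step: "\<And>s. s < t \<Longrightarrow> relax_step (g s) (g (Suc s)) (act s)"
    by metis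
  have init: "g 0 q = 0" for q
    using play unfolding greedy_play_def g_def excess_def by (intro sum.neutral) auto
  have anti: "g s r \<le> g s q" if "q \<le> r" for s q r
    unfolding g_def using that by (rule excess_antimono)
  have L: "L \<ge> 1 / 2"
    unfolding L_def using k by (intro ln_add_two_ge) simp
  \<comment> \<open>The barrier height is \<open>2 * K \<le> k / 2\<close>, below the backlog
    reached. \<open>B\<close> is \<open>(k / 8)\<^sup>2 / 2\<close>, from
    \<open>K \<ge> k / 8\<close>.\<close>
  define K where "K = nat \<lfloor>k / 4\<rfloor>"
  have K: "real K \<le> k / 4" "k / 8 \<le> real K" unfolding K_def using k by linarith+
  define B where "B = k\<^sup>2 / 128"
  have B: "B > 0" using k by (simp add: B_def)
  have "\<exists>u\<le>t. g u K > real K * (real K + 1) / 2"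
  proof (rule ccontr)
    assume "\<not> ?thesis"
    then have "g t (K + K) \<le> 0"
      by (intro staircase_barrier[OF step init]) (auto simp: not_less)
    moreover have "max 0 (xs t i - real (K + K)) \<le> g t (K + K)"
      unfolding g_def excess_def using i
      by (intro member_le_sum[of i _ "\<lambda>i. max 0 (xs t i - real (K + K))"]) auto
    ultimately show False using i(2) K(1) k by simp
  qed
  then obtain u where u: "u \<le> t" "g u K > real K * (real K + 1) / 2" by blast
  have "B \<le> real K * (real K + 1) / 2"
  proof -
    have "(k / 8)\<^sup>2 \<le> real K ^ 2" using K k by (intro power_mono) auto
    then show ?thesis using K k by (simp add: B_def power2_eq_square algebra_simps)
  qed
  then have uB: "B \<le> g u K" using u by simp
  have bound: "g s 0 \<le> exp (9 * L) * B" if "s \<le> t" for s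
  proof -
    \<comment> \<open>Fills stay below \<open>k\<close> before time \<open>t\<close>, and the last
      round adds at most 1.\<close>
    have "xs s j \<le> k + 1" if j: "j < n" for j
    proof (cases "s < t")
      case True
      then show ?thesis using first j by fastforce
    next
      case False
      then obtain r where r: "s = Suc r" "r < t" using t0 \<open>s \<le> t\<close> by (cases s) auto
      then obtain p a where "greedy_round n (xs r) p a (xs s)" using rounds by blast
      from greedy_round_increase_le[OF this j] first[OF r(2) j] k show ?thesis by simp
    qed
    then have "max 0 (xs s j - real 0) \<le> 2 * k" if "j < n" for j
      using that k by force
    then have "g s 0 \<le> real n * (2 * k)"
      unfolding g_def excess_def using sum_bounded_above[of "{..<n}" "\<lambda>j. max 0 (xs s j - real 0)"]
      by simp
    also have "\<dots> = 256 * (real n / k) * B"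
      using k by (simp add: B_def power2_eq_square field_simps)
    also have "\<dots> \<le> exp (9 * L) * B"
    proof -
      define z where "z = real n / k + 2"
      have z: "z \<ge> 2" using k by (simp add: z_def)
      have "256 * (real n / k) \<le> 2 ^ 8 * z" by (simp add: z_def)
      \<comment> \<open>As \<open>z \<ge> 2\<close>, the factor \<open>2 ^ 8\<close> is absorbed
        into powers of \<open>z = exp L\<close>; this is the origin of the 9.\<close>
      also have "\<dots> \<le> z ^ 8 * z" using z by (intro mult_right_mono power_mono) auto
      also have "\<dots> = exp L ^ 9" using z unfolding L_def z_def[symmetric] by (simp add: power_Suc2[symmetric])
      also have "\<dots> = exp (9 * L)" by (simp add: exp_of_nat_mult[symmetric])
      finally show ?thesis using B by (intro mult_right_mono) auto
    qed
    finally show ?thesis .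
  qed
  define M where "M = nat \<lceil>9 * L\<rceil>"
  have M: "9 * L \<le> real M" "real M \<le> 11 * L" "M > 0"
    unfolding M_def using L by linarith+
  define w where "w = K div M"
  \<comment> \<open>The assumption \<open>k \<ge> 88 * L\<close> gives
    \<open>11 * L \<le> k / 8\<close>, so the blocks have positive width.\<close>
  have "real M \<le> real K" using M(2) K(2) large by linarith
  then have MK: "M \<le> K" by simp
  have w: "w > 0" unfolding w_def using MK M(3) by (simp add: div_greater_zero_iff)
  have wK: "real K \<le> 2 * real M * real w"
  proof -
    have "K < M * w + M"
      unfolding w_def using mod_less_divisor[OF M(3), of K] mult_div_mod_eq[of M K] by linarith
    also have "\<dots> \<le> 2 * M * w" using w by (cases w) auto
    finally have "real K \<le> real (2 * M * w)" unfolding of_nat_le_iff by simp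
    then show ?thesis by simp
  qed
  have "B \<le> g u (M * w)"
    using uB anti[of "M * w" K u] unfolding w_def by simp
  from crossing_time[OF step init anti bound u(1) this B w M(1)]
  have t: "exp (- 3) * real M * real w ^ 3 / 8 \<le> real t" .
  have e: "1 / 27 \<le> exp (- 3 :: real)"
  proof -
    have "exp 3 = exp (1::real) ^ 3" by (simp add: exp_of_nat_mult[symmetric])
    also have "\<dots> \<le> 3 ^ 3" using exp_le by (intro power_mono) auto
    finally show ?thesis by (simp add: exp_minus field_simps)
  qed
  \<comment> \<open>Constants: \<open>4096 = 8 ^ 3 * 2 ^ 3\<close>, then \<open>11\<^sup>2\<close>
    from \<open>M \<le> 11 * L\<close>, 27 from \<open>exp 3\<close>, and 8 from the block bound;
    their product is below \<open>2 ^ 27\<close>.\<close>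
  have "k ^ 3 / 512 \<le> real K ^ 3"
    using power_mono[OF K(2), of 3] k by (simp add: power_divide)
  also have "\<dots> \<le> (2 * real M * real w) ^ 3"
    using wK by (intro power_mono) auto
  finally have "k ^ 3 \<le> 4096 * (real M)\<^sup>2 * (real M * real w ^ 3)"
    by (simp add: power2_eq_square power3_eq_cube algebra_simps)
  also have "\<dots> \<le> 4096 * (11 * L)\<^sup>2 * (real M * real w ^ 3)"
    using M by (intro mult_right_mono mult_left_mono power_mono) auto
  finally have "k ^ 3 / L\<^sup>2 \<le> 495616 * (real M * real w ^ 3)"
    using L by (simp add: field_simps power2_eq_square)
  moreover have "(1 / 27) * (real M * real w ^ 3) \<le> exp (- 3) * (real M * real w ^ 3)"
    using e by (intro mult_right_mono) auto
  ultimately show ?thesis using t by simp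
qed

theorem theorem6p1:
  shows "\<forall>C::real. C \<ge> 1 \<longrightarrow> (\<exists>c::real. c > 0 \<and>
     (\<forall>(n::nat) (k::real). 1 \<le> k \<and> k \<le> C * real n \<longrightarrow>
        (\<forall>xs t. greedy_play n xs t \<and> (\<exists>i<n. xs t i \<ge> k) \<longrightarrow>
           real t \<ge> c * (k + k ^ 3 / (ln (real n / k + 2)) ^ 2))))"
proof (intro allI impI exI[of _ "1 / 2 ^ 28"] conjI)
  fix C k :: real and n t :: nat and xs
  assume k: "1 \<le> k \<and> k \<le> C * real n" and play: "greedy_play n xs t \<and> (\<exists>i<n. xs t i \<ge> k)"
  define L where "L = ln (real n / k + 2)"
  \<comment> \<open>Stopping at the first time backlog \<open>k\<close> occurs keeps all earlier
    fills below \<open>k\<close>.\<close>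
  define \<tau> where "\<tau> = (LEAST s. \<exists>i<n. xs s i \<ge> k)"
  have \<tau>: "\<exists>i<n. xs \<tau> i \<ge> k" "\<tau> \<le> t"
    using LeastI[of "\<lambda>s. \<exists>i<n. xs s i \<ge> k" t] Least_le[of "\<lambda>s. \<exists>i<n. xs s i \<ge> k" t] play
    unfolding \<tau>_def by blast+
  then obtain i where i: "i < n" "xs \<tau> i \<ge> k" by blast
  have first: "xs s j < k" if "s < \<tau>" "j < n" for s j
    using not_less_Least[of s "\<lambda>s. \<exists>i<n. xs s i \<ge> k"] that unfolding \<tau>_def by force
  have play': "greedy_play n xs \<tau>"
    using play \<tau>(2) unfolding greedy_play_def by auto
  have lin: "k \<le> real \<tau>"
    using greedy_play_fill_le[OF play' order_refl i(1)] i(2) by simp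
  have L: "L \<ge> 1 / 2"
    unfolding L_def using k by (intro ln_add_two_ge) simp
  have cub: "k ^ 3 / L\<^sup>2 \<le> 2 ^ 27 * real \<tau>"
  proof (cases "k \<ge> 8 \<and> k \<ge> 88 * L")
    case True
    then have "k ^ 3 / L\<^sup>2 / 2 ^ 27 \<le> real \<tau>"
      unfolding L_def by (intro greedy_backlog_cubic_time[OF play' i first]) auto
    then show ?thesis by simp
  next
    case False
    \<comment> \<open>The case \<open>k < 8\<close> is included because
      \<open>88 * L \<ge> 44\<close>. Here the cubic term is at most a constant times
      \<open>k\<close>, so the linear bound suffices.\<close>
    then have "k \<le> 88 * L" using L by linarith
    then have "k\<^sup>2 \<le> (88 * L)\<^sup>2" using k by (intro power_mono) auto
    then have "k * k\<^sup>2 \<le> k * (88 * L)\<^sup>2" using k by (intro mult_left_mono) auto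
    then have "k ^ 3 / L\<^sup>2 \<le> 7744 * k"
      using L by (simp add: field_simps power2_eq_square power3_eq_cube)
    then show ?thesis using lin by simp
  qed
  have "1 / 2 ^ 28 * (k + k ^ 3 / L\<^sup>2) \<le> real \<tau>" using cub lin by simp
  then show "real t \<ge> 1 / 2 ^ 28 * (k + k ^ 3 / (ln (real n / k + 2)) ^ 2)"
    using \<tau>(2) unfolding L_def by linarith
qed simp

end
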